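(* Let $\mathcal H_i,\mathcal H_o$ be finite-dimensional complex Hilbert spaces with fixed computational (orthonormal) bases, let $\widetilde P_i:\mathcal L(\mathcal H_i)\to\mathcal L(\mathcal H_i)$ and $\widetilde P_o:\mathcal L(\mathcal H_o)\to\mathcal L(\mathcal H_o)$ be linear maps with $\widetilde P_i^2=\widetilde P_i$ and $\widetilde P_o^2=\widetilde P_o$, let $\gamma_i,\gamma_o\in\mathbb C$ with $\gamma_i\neq0$, and define $$\mathcal S_i=\{W\in\mathcal L(\mathcal H_i):\widetilde P_i[W]=W,\ \operatorname{tr}[W]=\gamma_i\},\qquad \mathcal S_o=\{W'\in\mathcal L(\mathcal H_o):\widetilde P_o[W']=W',\ \operatorname{tr}[W']=\gamma_o\}.$$ Assume $\mathcal S_i$ is nonempty. Then a linear map $\widetilde T_{io}:\mathcal L(\mathcal H_i)\to\mathcal L(\mathcal H_o)$ satisfies $\widetilde T_{io}[W]\in\mathcal S_o$ for all $W\in\mathcal S_i$ if and only if its Choi matrix $T_{io}$ satisfies $$T_{io}=T_{io}-(\widetilde P_i^{\tau}\otimes\widetilde{\mathbb 1}_o)[T_{io}]+(\widetilde P_i^{\tau}\otimes\widetilde P_o)[T_{io}]$$ and $$\widetilde P_i^{\tau}\big[\operatorname{tr}_o T_{io}\big]=\frac{\gamma_o}{\gamma_i}\,\widetilde P_i^{\tau}[\mathbb 1_i].$$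
   Context: $\mathcal L(\mathcal H)$ is the space of linear operators on $\mathcal H$. The Choi matrix of $\widetilde T:\mathcal L(\mathcal H_i)\to\mathcal L(\mathcal H_o)$ is $T=\sum_{jk}|j\rangle\langle k|\otimes\widetilde T[|j\rangle\langle k|]\in\mathcal L(\mathcal H_i\otimes\mathcal H_o)$, with $\{|j\rangle\}$ the computational basis of $\mathcal H_i$. The adjoint $\widetilde P^\dagger$ of a linear map is defined by $\operatorname{tr}[B^\dagger\widetilde P[A]]=\operatorname{tr}[\widetilde P^\dagger[B]^\dagger A]$ for all $A,B$. For a linear map $\widetilde P_i$ on $\mathcal L(\mathcal H_i)$, $\widetilde P_i^\tau$ is the linear map $\widetilde P_i^\tau[A]:=\big(\widetilde P_i^\dagger[A^*]\big)^*$, where $*$ is entrywise complex conjugation in the computational basis. $\widetilde{\mathbb 1}_o$ is the identity map on $\mathcal L(\mathcal H_o)$. *)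

theory Defs
  imports "HOL-Analysis.Analysis"
begin

text \<open>
  A finite-dimensional Hilbert space with a fixed computational basis indexed by the finite type
  \<open>'n\<close> is \<open>complex ^ 'n\<close>; its operators are identified with their matrices in that basis
  (row index first). The tensor product of the spaces indexed by \<open>'i\<close> and \<open>'o\<close> is indexed by
  \<open>'i \<times> 'o\<close>.
\<close>

type_synonym 'n operator = "complex ^ 'n ^ 'n"

text \<open>The library's \<open>*s\<close> on matrices would only scale by row vectors, and \<open>*\<^sub>R\<close> only by reals.\<close>

definition op_scale :: "complex \<Rightarrow> ('n::finite) operator \<Rightarrow> 'n operator"  (infixr "*\<^sub>C" 75)
  where "c *\<^sub>C A = (\<chi> r s. c * A $ r $ s)"

lemma vector_space_op_scale: "vector_space op_scale"
  by unfold_locales (simp_all add: op_scale_def vec_eq_iff algebra_simps)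

abbreviation op_linear :: "(('m::finite) operator \<Rightarrow> ('n::finite) operator) \<Rightarrow> bool"
  where "op_linear \<equiv> Vector_Spaces.linear op_scale op_scale"

lemma op_linear_iff:
  "op_linear f \<longleftrightarrow> (\<forall>A B. f (A + B) = f A + f B) \<and> (\<forall>c A. f (c *\<^sub>C A) = c *\<^sub>C f A)"
  by (auto simp: Vector_Spaces.linear_iff vector_space_op_scale)

definition ketbra :: "'n \<Rightarrow> 'n \<Rightarrow> ('n::finite) operator"
  where "ketbra j k = (\<chi> r s. if r = j \<and> s = k then 1 else 0)"

definition op_cnj :: "('n::finite) operator \<Rightarrow> 'n operator"
  where "op_cnj A = (\<chi> r s. cnj (A $ r $ s))"

definition dagger :: "('n::finite) operator \<Rightarrow> 'n operator"
  where "dagger A = transpose (op_cnj A)"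

definition op_tensor :: "('i::finite) operator \<Rightarrow> ('o::finite) operator \<Rightarrow> ('i \<times> 'o) operator"
  (infixr "\<otimes>\<^sub>o" 70)
  where "A \<otimes>\<^sub>o B = (\<chi> r s. A $ fst r $ fst s * B $ snd r $ snd s)"

text \<open>
  The tensor product of linear maps, by linear extension from the basis
  \<open>ketbra j k \<otimes>\<^sub>o ketbra a b\<close>; its characteristic property is shown below.
\<close>

definition map_tensor ::
  "(('i::finite) operator \<Rightarrow> ('i2::finite) operator) \<Rightarrow> (('o::finite) operator \<Rightarrow> ('o2::finite) operator)
    \<Rightarrow> ('i \<times> 'o) operator \<Rightarrow> ('i2 \<times> 'o2) operator"
  (infixr "\<otimes>\<^sub>m" 70)
  where "(P \<otimes>\<^sub>m Q) M =
    (\<Sum>j\<in>UNIV. \<Sum>a\<in>UNIV. \<Sum>k\<in>UNIV. \<Sum>b\<in>UNIV.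
       (M $ (j, a) $ (k, b)) *\<^sub>C (P (ketbra j k) \<otimes>\<^sub>o Q (ketbra a b)))"

definition partial_trace_out :: "(('i::finite) \<times> ('o::finite)) operator \<Rightarrow> 'i operator"
  where "partial_trace_out M = (\<chi> j k. \<Sum>a\<in>UNIV. M $ (j, a) $ (k, a))"

definition choi :: "(('i::finite) operator \<Rightarrow> ('o::finite) operator) \<Rightarrow> ('i \<times> 'o) operator"
  where "choi T = (\<Sum>j\<in>UNIV. \<Sum>k\<in>UNIV. ketbra j k \<otimes>\<^sub>o T (ketbra j k))"

text \<open>
  The library's \<open>adjoint\<close> is taken with respect to a real inner product; this one is the adjoint
  for the complex Hilbert--Schmidt inner product. Existence and uniqueness are shown below.
\<close>

definition hs_adjoint ::
  "(('m::finite) operator \<Rightarrow> ('n::finite) operator) \<Rightarrow> 'n operator \<Rightarrow> 'm operator"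
  where "hs_adjoint P =
    (THE Q. \<forall>A B. trace (dagger B ** P A) = trace (dagger (Q B) ** A))"

definition tau :: "(('n::finite) operator \<Rightarrow> 'n operator) \<Rightarrow> 'n operator \<Rightarrow> 'n operator"
  where "tau P A = op_cnj (hs_adjoint P (op_cnj A))"

definition constraint_set :: "(('n::finite) operator \<Rightarrow> 'n operator) \<Rightarrow> complex \<Rightarrow> 'n operator set"
  where "constraint_set P \<gamma> = {W. P W = W \<and> trace W = \<gamma>}"


subsection \<open>Well-definedness\<close>

lemma op_linear_sum:
  assumes "op_linear f" shows "f (\<Sum>x\<in>X. g x) = (\<Sum>x\<in>X. f (g x))"
proof -
  interpret Vector_Spaces.linear op_scale op_scale f by fact
  show ?thesis by (rule sum)
qed

lemma sum_prod_delta: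
  fixes f :: "'a::finite \<Rightarrow> 'b::finite \<Rightarrow> complex"
  shows "(\<Sum>j\<in>UNIV. \<Sum>k\<in>UNIV. if r = j \<and> s = k then f j k else 0) = f r s"
proof -
  have "(\<Sum>k\<in>UNIV. if r = j \<and> s = k then f j k else 0) = (if r = j then f j s else 0)" for j
    by (cases "r = j") (simp_all add: sum.delta')
  then show ?thesis by (simp add: sum.delta')
qed

lemma ketbra_expand: "A = (\<Sum>j\<in>UNIV. \<Sum>k\<in>UNIV. (A $ j $ k) *\<^sub>C ketbra j k)"
proof -
  have "(\<Sum>j\<in>UNIV. \<Sum>k\<in>UNIV. (A $ j $ k) *\<^sub>C ketbra j k) $ r $ s =
      (\<Sum>j\<in>UNIV. \<Sum>k\<in>UNIV. if r = j \<and> s = k then A $ j $ k else 0)" for r s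
    by (auto simp: sum_component op_scale_def ketbra_def intro!: sum.cong)
  then show ?thesis by (simp add: vec_eq_iff sum_prod_delta)
qed

lemma op_linear_expand:
  assumes "op_linear f"
  shows "f A = (\<Sum>j\<in>UNIV. \<Sum>k\<in>UNIV. (A $ j $ k) *\<^sub>C f (ketbra j k))"
proof -
  have "f A = f (\<Sum>j\<in>UNIV. \<Sum>k\<in>UNIV. (A $ j $ k) *\<^sub>C ketbra j k)"
    using ketbra_expand[of A] by simp
  also have "\<dots> = (\<Sum>j\<in>UNIV. \<Sum>k\<in>UNIV. (A $ j $ k) *\<^sub>C f (ketbra j k))"
    using assms by (simp add: op_linear_sum) (simp add: op_linear_iff)
  finally show ?thesis .
qed

lemma trace_dagger_mult:
  "trace (dagger B ** A) = (\<Sum>s\<in>UNIV. \<Sum>r\<in>UNIV. cnj (B $ r $ s) * A $ r $ s)"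
  by (simp add: trace_def dagger_def op_cnj_def transpose_def matrix_matrix_mult_def)

lemma trace_dagger_ketbra: "trace (dagger B ** ketbra j k) = cnj (B $ j $ k)"
proof -
  have "trace (dagger B ** ketbra j k) =
      (\<Sum>s\<in>UNIV. \<Sum>r\<in>UNIV. if k = s \<and> j = r then cnj (B $ r $ s) else 0)"
    unfolding trace_dagger_mult ketbra_def by (auto intro!: sum.cong)
  then show ?thesis by (simp add: sum_prod_delta)
qed

lemma trace_dagger_sum:
  "trace (dagger B ** (\<Sum>x\<in>X. g x)) = (\<Sum>x\<in>X. trace (dagger B ** g x))"
  by (induction X rule: infinite_finite_induct)
     (simp_all add: trace_def matrix_add_ldistrib sum.distrib)

lemma trace_dagger_scale: "trace (dagger B ** (c *\<^sub>C A)) = c * trace (dagger B ** A)"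
  by (simp add: trace_dagger_mult op_scale_def sum_distrib_left mult_ac)

lemma hs_adjoint_ex1:
  assumes "op_linear P"
  shows "\<exists>!Q. \<forall>A B. trace (dagger B ** P A) = trace (dagger (Q B) ** A)"
proof (rule ex1I)
  let ?Q = "\<lambda>B. \<chi> j k. cnj (trace (dagger B ** P (ketbra j k)))"
  show "\<forall>A B. trace (dagger B ** P A) = trace (dagger (?Q B) ** A)"
  proof (intro allI)
    fix A B
    have "trace (dagger B ** P A)
        = (\<Sum>j\<in>UNIV. \<Sum>k\<in>UNIV. A $ j $ k * trace (dagger B ** P (ketbra j k)))"
      by (subst op_linear_expand[OF assms]) (simp add: trace_dagger_sum trace_dagger_scale)
    also have "\<dots> = trace (dagger (?Q B) ** A)"
      by (subst sum.swap) (simp add: trace_dagger_mult[of "?Q B"] mult.commute)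
    finally show "trace (dagger B ** P A) = trace (dagger (?Q B) ** A)" .
  qed
next
  fix Q assume Q: "\<forall>A B. trace (dagger B ** P A) = trace (dagger (Q B) ** A)"
  show "Q = (\<lambda>B. \<chi> j k. cnj (trace (dagger B ** P (ketbra j k))))"
    by (simp add: fun_eq_iff vec_eq_iff Q trace_dagger_ketbra)
qed

lemma hs_adjoint:
  assumes "op_linear P"
  shows "trace (dagger B ** P A) = trace (dagger (hs_adjoint P B) ** A)"
  using theI'[OF hs_adjoint_ex1[OF assms]] unfolding hs_adjoint_def by blast

lemma map_tensor_linear: "op_linear (P \<otimes>\<^sub>m Q)"
  by (simp add: op_linear_iff map_tensor_def op_scale_def vec_eq_iff sum_component
      sum.distrib sum_distrib_left algebra_simps)

lemma map_tensor_op_tensor: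
  assumes "op_linear P" "op_linear Q"
  shows "(P \<otimes>\<^sub>m Q) (A \<otimes>\<^sub>o B) = P A \<otimes>\<^sub>o Q B"
proof -
  have "(P A \<otimes>\<^sub>o Q B) = (\<Sum>j\<in>UNIV. \<Sum>k\<in>UNIV. (A $ j $ k) *\<^sub>C P (ketbra j k))
      \<otimes>\<^sub>o (\<Sum>a\<in>UNIV. \<Sum>b\<in>UNIV. (B $ a $ b) *\<^sub>C Q (ketbra a b))"
    using op_linear_expand[OF assms(1), of A] op_linear_expand[OF assms(2), of B] by simp
  also have "\<dots> = (\<Sum>j\<in>UNIV. \<Sum>k\<in>UNIV. \<Sum>a\<in>UNIV. \<Sum>b\<in>UNIV.
      (A $ j $ k * B $ a $ b) *\<^sub>C (P (ketbra j k) \<otimes>\<^sub>o Q (ketbra a b)))"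
    by (simp add: vec_eq_iff op_tensor_def sum_component op_scale_def
        sum_distrib_right) (simp add: sum_distrib_left mult_ac)
  also have "\<dots> = (P \<otimes>\<^sub>m Q) (A \<otimes>\<^sub>o B)"
    unfolding map_tensor_def
    by (rule sum.cong[OF refl], subst sum.swap) (simp add: op_tensor_def)
  finally show ?thesis by simp
qed

end

theory Submission
  imports Defs
begin

text \<open>
  The map \<open>tau P\<close> is the transpose of \<open>P\<close> for the bilinear form
  \<open>(A, B) \<mapsto> \<Sum>j k. A\<^sub>j\<^sub>k B\<^sub>j\<^sub>k\<close>. Hence \<open>(tau P \<otimes>\<^sub>m Q) (choi T) = choi (Q \<circ> T \<circ> P)\<close>, and since
  \<open>choi\<close> is injective the two conditions say that \<open>P\<^sub>o (T X) = T X\<close> and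
  \<open>trace (T X) = (\<gamma>\<^sub>o / \<gamma>\<^sub>i) trace X\<close> for every \<open>X\<close> in the range of \<open>P\<^sub>i\<close>. Given one
  \<open>W\<close> in the input set, every fixed point \<open>X\<close> of \<open>P\<^sub>i\<close> differs by a multiple of \<open>W\<close> from one of
  trace zero, and adding the latter to \<open>W\<close> stays in the input set.
\<close>

lemma hs_adjoint_nth:
  assumes "op_linear P"
  shows "hs_adjoint P B $ j $ k = cnj (trace (dagger B ** P (ketbra j k)))"
  by (simp add: hs_adjoint[OF assms] trace_dagger_ketbra)

text \<open>Conjugating the argument cancels the conjugate in \<open>dagger\<close>, and the outer
  \<open>op_cnj\<close> cancels the one in \<open>hs_adjoint_nth\<close>. What remains is complex
  linear in \<open>A\<close>.\<close>

lemma tau_nth: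
  assumes "op_linear P"
  shows "tau P A $ j $ k = (\<Sum>m\<in>UNIV. \<Sum>n\<in>UNIV. A $ m $ n * P (ketbra j k) $ m $ n)"
  unfolding tau_def op_cnj_def
  by (subst sum.swap) (simp add: hs_adjoint_nth[OF assms] trace_dagger_mult)

lemma op_linear_tau:
  assumes "op_linear P"
  shows "op_linear (tau P)"
  by (simp add: op_linear_iff vec_eq_iff tau_nth[OF assms] op_scale_def
      sum.distrib sum_distrib_left algebra_simps)

lemma op_linear_id: "op_linear id"
  by (simp add: op_linear_iff)

lemma trace_op_scale: "trace (c *\<^sub>C A) = c * trace A"
  by (simp add: trace_def op_scale_def sum_distrib_left)

text \<open>In the basis of matrix units, \<open>tau P\<close> is the plain transpose of
  \<open>P\<close>; this is what moves \<open>P\<close> from the Choi matrix to the argument of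
  \<open>T\<close>.\<close>

lemma tau_ketbra_nth:
  assumes "op_linear P"
  shows "tau P (ketbra m n) $ j $ k = P (ketbra j k) $ m $ n"
proof -
  have "tau P (ketbra m n) $ j $ k =
      (\<Sum>r\<in>UNIV. \<Sum>s\<in>UNIV. if m = r \<and> n = s then P (ketbra j k) $ r $ s else 0)"
    unfolding tau_nth[OF assms] ketbra_def by (auto intro!: sum.cong)
  then show ?thesis by (simp add: sum_prod_delta)
qed

lemma choi_nth: "choi T $ (j, a) $ (k, b) = T (ketbra j k) $ a $ b"
proof -
  have "choi T $ (j, a) $ (k, b) =
      (\<Sum>m\<in>UNIV. \<Sum>n\<in>UNIV. if j = m \<and> k = n then T (ketbra m n) $ a $ b else 0)"
    by (auto simp: choi_def sum_component op_tensor_def ketbra_def intro!: sum.cong)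
  then show ?thesis by (simp add: sum_prod_delta)
qed

text \<open>The blocks of a Choi matrix are the values on matrix units, and these determine a linear
  map.\<close>

lemma choi_eq_iff:
  assumes "op_linear S" "op_linear T"
  shows "choi S = choi T \<longleftrightarrow> S = T"
proof
  assume eq: "choi S = choi T"
  have "S (ketbra j k) = T (ketbra j k)" for j k
    by (simp add: vec_eq_iff flip: choi_nth) (simp add: eq)
  then have "S A = T A" for A
    by (subst (1 2) op_linear_expand) (simp_all add: assms)
  then show "S = T" by blast
qed simp

text \<open>Entry \<open>(j, k)\<close> of \<open>tau P (ketbra m n)\<close> is the coefficient of
  \<open>ketbra m n\<close> in \<open>P (ketbra j k)\<close>, so the sum over \<open>m\<close> and
  \<open>n\<close> reassembles \<open>Q (T (P (ketbra j k)))\<close>.\<close>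

lemma map_tensor_tau_choi:
  assumes P: "op_linear P" and Q: "op_linear Q" and T: "op_linear T"
  shows "(tau P \<otimes>\<^sub>m Q) (choi T) = choi (Q \<circ> T \<circ> P)"
proof -
  have "((tau P \<otimes>\<^sub>m Q) (choi T)) $ (j, a) $ (k, b) = choi (Q \<circ> T \<circ> P) $ (j, a) $ (k, b)"
    for j a k b
  proof -
    let ?A = "P (ketbra j k)"
    have QT: "op_linear (Q \<circ> T)"
      using Q T by (simp add: op_linear_iff)
    have "(tau P \<otimes>\<^sub>m Q) (choi T) =
        (\<Sum>m\<in>UNIV. \<Sum>n\<in>UNIV. tau P (ketbra m n) \<otimes>\<^sub>o Q (T (ketbra m n)))"
      by (simp add: choi_def op_linear_sum[OF map_tensor_linear]
          map_tensor_op_tensor[OF op_linear_tau[OF P] Q])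
    then have "((tau P \<otimes>\<^sub>m Q) (choi T)) $ (j, a) $ (k, b) =
        (\<Sum>m\<in>UNIV. \<Sum>n\<in>UNIV. ?A $ m $ n * Q (T (ketbra m n)) $ a $ b)"
      by (simp add: sum_component op_tensor_def tau_ketbra_nth[OF P])
    also have "\<dots> = (Q \<circ> T) ?A $ a $ b"
      by (subst op_linear_expand[OF QT]) (simp add: sum_component op_scale_def)
    finally show ?thesis by (simp add: choi_nth)
  qed
  then show ?thesis by (simp add: vec_eq_iff)
qed

text \<open>Under the bilinear pairing, the partial trace represents the functional
  \<open>trace \<circ> T\<close>, and \<open>tau P\<close> precomposes it with \<open>P\<close>.
  Likewise \<open>mat 1\<close> represents \<open>trace\<close> in the next lemma.\<close>

lemma tau_partial_trace_choi_nth: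
  assumes P: "op_linear P" and T: "op_linear T"
  shows "tau P (partial_trace_out (choi T)) $ j $ k = trace (T (P (ketbra j k)))"
proof -
  let ?A = "P (ketbra j k)"
  have "trace (T ?A) =
      (\<Sum>a\<in>UNIV. \<Sum>m\<in>UNIV. \<Sum>n\<in>UNIV. ?A $ m $ n * T (ketbra m n) $ a $ a)"
    by (subst op_linear_expand[OF T]) (simp add: trace_def sum_component op_scale_def)
  also have "\<dots> = (\<Sum>m\<in>UNIV. \<Sum>n\<in>UNIV. \<Sum>a\<in>UNIV. ?A $ m $ n * T (ketbra m n) $ a $ a)"
    by (subst sum.swap, rule sum.cong[OF refl], rule sum.swap)
  also have "\<dots> = tau P (partial_trace_out (choi T)) $ j $ k"
    by (simp add: tau_nth[OF P] partial_trace_out_def choi_nth sum_distrib_left mult.commute)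
  finally show ?thesis by simp
qed

lemma tau_mat_1_nth:
  assumes "op_linear P"
  shows "tau P (mat 1) $ j $ k = trace (P (ketbra j k))"
  by (simp add: tau_nth[OF assms] mat_def trace_def if_distrib[of "\<lambda>c. c * _"] sum.delta
      cong: if_cong)

text \<open>Both sides are linear in \<open>A\<close>, so the entrywise matrix condition extends
  from matrix units to all operators.\<close>

lemma trace_condition_ketbra:
  assumes P: "op_linear P" and T: "op_linear T"
    and ket: "\<And>j k. trace (T (P (ketbra j k))) = c * trace (P (ketbra j k))"
  shows "trace (T (P A)) = c * trace (P A)"
proof -
  have tr_sum: "trace (\<Sum>x\<in>X. g x) = (\<Sum>x\<in>X. trace (g x :: 'n operator))"
    for g :: "'x \<Rightarrow> ('n::finite) operator" and X
    by (simp add: trace_def sum_component) (rule sum.swap)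
  have TP: "op_linear (T \<circ> P)"
    using P T by (simp add: op_linear_iff)
  show ?thesis
    using op_linear_expand[OF TP, of A] op_linear_expand[OF P, of A]
    by (simp add: tr_sum trace_op_scale ket sum_distrib_left mult_ac)
qed

lemma op_linear_diff:
  assumes "op_linear f"
  shows "f (A - B) = f A - f B"
proof -
  interpret Vector_Spaces.linear op_scale op_scale f by fact
  show ?thesis by (rule diff)
qed

lemma choi_conditions_iff:
  assumes Pi: "op_linear P\<^sub>i" and Po: "op_linear P\<^sub>o" and T: "op_linear T"
  shows "choi T = choi T - (tau P\<^sub>i \<otimes>\<^sub>m id) (choi T) + (tau P\<^sub>i \<otimes>\<^sub>m P\<^sub>o) (choi T) \<and>
      tau P\<^sub>i (partial_trace_out (choi T)) = c *\<^sub>C tau P\<^sub>i (mat 1) \<longleftrightarrow>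
    (\<forall>A. P\<^sub>o (T (P\<^sub>i A)) = T (P\<^sub>i A) \<and> trace (T (P\<^sub>i A)) = c * trace (P\<^sub>i A))"
proof -
  have TP: "op_linear (T \<circ> P\<^sub>i)" and PTP: "op_linear (P\<^sub>o \<circ> T \<circ> P\<^sub>i)"
    using assms by (simp_all add: op_linear_iff)
  \<comment> \<open>After \<open>choi T\<close> cancels, the two tensor terms are the Choi matrices
    of \<open>T \<circ> P\<^sub>i\<close> and
    \<open>P\<^sub>o \<circ> T \<circ> P\<^sub>i\<close>.\<close>
  have "choi T = choi T - (tau P\<^sub>i \<otimes>\<^sub>m id) (choi T) + (tau P\<^sub>i \<otimes>\<^sub>m P\<^sub>o) (choi T) \<longleftrightarrow>
      choi (P\<^sub>o \<circ> T \<circ> P\<^sub>i) = choi (T \<circ> P\<^sub>i)"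
    by (auto simp: map_tensor_tau_choi assms op_linear_id algebra_simps)
  also have "\<dots> \<longleftrightarrow> (\<forall>A. P\<^sub>o (T (P\<^sub>i A)) = T (P\<^sub>i A))"
    by (simp add: choi_eq_iff TP PTP fun_eq_iff)
  finally have 1: "choi T = choi T - (tau P\<^sub>i \<otimes>\<^sub>m id) (choi T) + (tau P\<^sub>i \<otimes>\<^sub>m P\<^sub>o) (choi T) \<longleftrightarrow>
      (\<forall>A. P\<^sub>o (T (P\<^sub>i A)) = T (P\<^sub>i A))" .
  have "tau P\<^sub>i (partial_trace_out (choi T)) = c *\<^sub>C tau P\<^sub>i (mat 1) \<longleftrightarrow>
      (\<forall>j k. trace (T (P\<^sub>i (ketbra j k))) = c * trace (P\<^sub>i (ketbra j k)))"
    by (simp add: vec_eq_iff tau_partial_trace_choi_nth[OF Pi T] tau_mat_1_nth[OF Pi] op_scale_def)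
  also have "\<dots> \<longleftrightarrow> (\<forall>A. trace (T (P\<^sub>i A)) = c * trace (P\<^sub>i A))"
    using trace_condition_ketbra[OF Pi T] by blast
  finally show ?thesis using 1 by blast
qed

theorem theorem5:
  fixes P\<^sub>i :: "('i::finite) operator \<Rightarrow> 'i operator"
    and P\<^sub>o :: "('o::finite) operator \<Rightarrow> 'o operator"
    and \<gamma>\<^sub>i \<gamma>\<^sub>o :: complex
    and T :: "'i operator \<Rightarrow> 'o operator"
  assumes "op_linear P\<^sub>i" and "op_linear P\<^sub>o"
    and "P\<^sub>i \<circ> P\<^sub>i = P\<^sub>i" and "P\<^sub>o \<circ> P\<^sub>o = P\<^sub>o"
    and "\<gamma>\<^sub>i \<noteq> 0"
    and "constraint_set P\<^sub>i \<gamma>\<^sub>i \<noteq> {}"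
    and "op_linear T"
  shows "(\<forall>W \<in> constraint_set P\<^sub>i \<gamma>\<^sub>i. T W \<in> constraint_set P\<^sub>o \<gamma>\<^sub>o) \<longleftrightarrow>
    choi T = choi T - (tau P\<^sub>i \<otimes>\<^sub>m id) (choi T) + (tau P\<^sub>i \<otimes>\<^sub>m P\<^sub>o) (choi T) \<and>
    tau P\<^sub>i (partial_trace_out (choi T)) = (\<gamma>\<^sub>o / \<gamma>\<^sub>i) *\<^sub>C tau P\<^sub>i (mat 1)"
proof -
  note Pi = \<open>op_linear P\<^sub>i\<close> and Po = \<open>op_linear P\<^sub>o\<close> and T = \<open>op_linear T\<close>
  have idem: "P\<^sub>i (P\<^sub>i A) = P\<^sub>i A" for A
    using \<open>P\<^sub>i \<circ> P\<^sub>i = P\<^sub>i\<close> by (metis comp_apply)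
  obtain W where W: "P\<^sub>i W = W" "trace W = \<gamma>\<^sub>i"
    using \<open>constraint_set P\<^sub>i \<gamma>\<^sub>i \<noteq> {}\<close> by (auto simp: constraint_set_def)
  have "(\<forall>V \<in> constraint_set P\<^sub>i \<gamma>\<^sub>i. T V \<in> constraint_set P\<^sub>o \<gamma>\<^sub>o) \<longleftrightarrow>
    (\<forall>A. P\<^sub>o (T (P\<^sub>i A)) = T (P\<^sub>i A) \<and> trace (T (P\<^sub>i A)) = \<gamma>\<^sub>o / \<gamma>\<^sub>i * trace (P\<^sub>i A))"
    (is "?maps \<longleftrightarrow> (\<forall>A. ?cond A)")
  proof
    assume maps: ?maps
    show "\<forall>A. ?cond A"
    proof
      fix A
      let ?X = "P\<^sub>i A"
      \<comment> \<open>This \<open>t\<close> is the multiple of \<open>W\<close> that has the same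
        trace as \<open>?X\<close>.\<close>
      define t where "t = trace ?X / \<gamma>\<^sub>i"
      define Z where "Z = ?X - t *\<^sub>C W"
      have "P\<^sub>i Z = Z"
        using Pi W(1) by (simp add: Z_def op_linear_diff idem) (simp add: op_linear_iff)
      moreover have "trace Z = 0"
        using \<open>\<gamma>\<^sub>i \<noteq> 0\<close> by (simp add: Z_def t_def trace_sub trace_op_scale W(2))
      \<comment> \<open>\<open>Z\<close> has trace zero and so lies outside the input set. Its image
        is controlled as the difference of the images of \<open>W + Z\<close> and
        \<open>W\<close>.\<close>
      ultimately have "W + Z \<in> constraint_set P\<^sub>i \<gamma>\<^sub>i"
        using Pi W by (simp add: constraint_set_def op_linear_iff trace_add)
      moreover have "W \<in> constraint_set P\<^sub>i \<gamma>\<^sub>i"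
        using W by (simp add: constraint_set_def)
      ultimately have TW: "P\<^sub>o (T W) = T W" "trace (T W) = \<gamma>\<^sub>o"
        and TWZ: "P\<^sub>o (T (W + Z)) = T (W + Z)" "trace (T (W + Z)) = \<gamma>\<^sub>o"
        using maps by (auto simp: constraint_set_def)
      have TZ: "P\<^sub>o (T Z) = T Z" "trace (T Z) = 0"
        using TWZ TW Po T by (simp_all add: op_linear_iff trace_add)
      \<comment> \<open>Only the \<open>W\<close> part contributes to the trace:
        \<open>t * \<gamma>\<^sub>o\<close> is the required multiple of
        \<open>trace ?X\<close>.\<close>
      have "T ?X = T Z + t *\<^sub>C T W"
        using T by (simp add: Z_def op_linear_diff) (simp add: op_linear_iff)
      then show "?cond A"
        using Po TZ TW by (simp add: op_linear_iff trace_add trace_op_scale t_def)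
    qed
  next
    assume cond: "\<forall>A. ?cond A"
    show ?maps
    proof
      fix V assume "V \<in> constraint_set P\<^sub>i \<gamma>\<^sub>i"
      then have "P\<^sub>i V = V" "trace V = \<gamma>\<^sub>i" by (auto simp: constraint_set_def)
      \<comment> \<open>As \<open>V\<close> is a fixed point, the condition applies with
        \<open>A = V\<close>, and the factor \<open>\<gamma>\<^sub>i\<close> cancels.\<close>
      then show "T V \<in> constraint_set P\<^sub>o \<gamma>\<^sub>o"
        using cond[rule_format, of V] \<open>\<gamma>\<^sub>i \<noteq> 0\<close> by (simp add: constraint_set_def)
    qed
  qed
  then show ?thesis
    by (simp only: choi_conditions_iff[OF Pi Po T])
qed

end
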